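(* Let $\mathbf{M}$ be a $t\times t$ branching matrix, $\lambda>0$, $d\ge1$ an integer and $M>0$. Suppose there are reals $a_{i,k},b_{i,k}$ ($i\in[t]$, $k=0,\dots,d-1$) such that: (1) for each $i\in[t]$ and each $i$-acceptable tuple $k=(k_0,k_1,\dots,k_{\Delta_i})$, $$(1-X_{k_0})\sum_{j=1}^{\Delta_i}\left(b_{t(j),k_j}-a_{t(j),k_j}X_{k_j}\right)<b_{i,k_0}-a_{i,k_0}Y_{k_0},$$ where $t(1),\dots,t(\Delta_i)$ is an enumeration of the multiset $\mathbf{M}_i$; and (2) for each $i\in[t]$ and $k=0,\dots,d-1$, $b_{i,k}-a_{i,k}Y_k>0$, $0\le a_{i,k}\le M$ and $0\le b_{i,k}\le M$. Then there exist $\gamma\in(0,1)$ and positive integrable functions $\Psi_1,\dots,\Psi_t$ on $I=[1/(1+\lambda),1]$ such that for every type $i$ and every choice of values $\alpha_w\in I$ for the elements $w$ of the multiset $\mathbf{M}_i$, $$\frac{1-\alpha_i}{\Psi_i(\alpha_i)}\sum_{w\in\mathbf{M}_i}\Psi_{t(w)}(\alpha_w)<\gamma,\qquad\text{where }\alpha_i=\Big(1+\lambda\prod_{w\in\mathbf{M}_i}\alpha_w\Big)^{-1}.$$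
   Context: A branching matrix is a square matrix with non-negative integer entries. The row $\mathbf{M}_i$ is viewed as a multiset of types containing $\mathbf{M}_{ij}$ copies of type $j$; $t(w)$ denotes the type of an element $w$, and $\Delta_i=\sum_j\mathbf{M}_{ij}$. Set $X_k=\frac{1}{1+\lambda}+k\frac{\lambda}{d(1+\lambda)}$ for $k=0,\dots,d$ and $Y_k=X_{k+1}$ for $k=0,\dots,d-1$, so the intervals $[X_k,Y_k]$ partition $I$. A tuple $k=(k_0,k_1,\dots,k_{\Delta_i})\in\{0,\dots,d-1\}^{\Delta_i+1}$ (with $k_j$ associated to the $j$-th element of $\mathbf{M}_i$) is $i$-acceptable if $[X_{k_0},Y_{k_0}]$ intersects $\left[\frac{1}{1+\lambda\prod_{j=1}^{\Delta_i}Y_{k_j}},\frac{1}{1+\lambda\prod_{j=1}^{\Delta_i}X_{k_j}}\right]$. *)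

theory Defs
  imports "HOL-Analysis.Analysis" "HOL-Library.Multiset"
begin

type_synonym 't branching_matrix = "nat ^ 't ^ 't"

definition row_mset :: "'t::finite branching_matrix \<Rightarrow> 't \<Rightarrow> 't multiset"
  where "row_mset M i = (\<Sum>j\<in>UNIV. replicate_mset (M $ i $ j) j)"

definition row_size :: "'t::finite branching_matrix \<Rightarrow> 't \<Rightarrow> nat"
  where "row_size M i = (\<Sum>j\<in>UNIV. M $ i $ j)"

text \<open>The elements of the multiset \<open>row_mset M i\<close>, with repetitions, are identified with the
  positions \<open>1, \<dots>, row_size M i\<close>; \<open>\<tau> i j\<close> is the type of the \<open>j\<close>-th element.\<close>

definition enumerates_rows ::
    "'t::finite branching_matrix \<Rightarrow> ('t \<Rightarrow> nat \<Rightarrow> 't) \<Rightarrow> bool"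
  where "enumerates_rows M \<tau> \<longleftrightarrow>
    (\<forall>i. image_mset (\<tau> i) (mset_set {1..row_size M i}) = row_mset M i)"

definition I_set :: "real \<Rightarrow> real set"
  where "I_set lam = {1 / (1 + lam)..1}"

definition X_pt :: "real \<Rightarrow> nat \<Rightarrow> nat \<Rightarrow> real"
  where "X_pt lam d k = 1 / (1 + lam) + real k * (lam / (real d * (1 + lam)))"

definition Y_pt :: "real \<Rightarrow> nat \<Rightarrow> nat \<Rightarrow> real"
  where "Y_pt lam d k = X_pt lam d (k + 1)"

text \<open>A tuple \<open>(k\<^sub>0, k\<^sub>1, \<dots>)\<close> of length \<open>row_size M i + 1\<close> is a function on \<open>nat\<close> of which only
  the values at \<open>0, \<dots>, row_size M i\<close> matter.\<close>

definition acceptable ::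
    "'t::finite branching_matrix \<Rightarrow> real \<Rightarrow> nat \<Rightarrow> 't \<Rightarrow> (nat \<Rightarrow> nat) \<Rightarrow> bool"
  where "acceptable M lam d i k \<longleftrightarrow>
    (\<forall>j\<in>{0..row_size M i}. k j \<in> {0..<d}) \<and>
    {X_pt lam d (k 0)..Y_pt lam d (k 0)} \<inter>
      {1 / (1 + lam * (\<Prod>j=1..row_size M i. Y_pt lam d (k j)))..
       1 / (1 + lam * (\<Prod>j=1..row_size M i. X_pt lam d (k j)))} \<noteq> {}"

end

theory Submission
  imports Defs
begin

text \<open>Take for \<open>\<Psi> i\<close> the step-wise affine function \<open>b i k - a i k * x\<close>, where \<open>k\<close> is the cell of
  the partition containing \<open>x\<close>. The cells of the \<open>\<alpha> j\<close> and of \<open>\<alpha>\<^sub>i\<close> form an acceptable tuple, and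
  monotonicity on each cell bounds the quotient by a number that depends on this tuple only and
  is below 1 by the first condition. There are finitely many tuples, hence a uniform
  \<open>\<gamma> < 1\<close>.\<close>

text \<open>The minimum puts the right end point of the interval, where the floor is \<open>d\<close>, into the
  last cell, and keeps the value below \<open>d\<close> for arguments outside the interval.\<close>

definition cell :: "real \<Rightarrow> nat \<Rightarrow> real \<Rightarrow> nat"
  where "cell lam d x = min (d - 1) (nat \<lfloor>(x - 1 / (1 + lam)) / (lam / (real d * (1 + lam)))\<rfloor>)"

lemma cell_less: "d \<ge> 1 \<Longrightarrow> cell lam d x < d"
  by (auto simp: cell_def)

lemma measurable_cell [measurable]: "cell lam d \<in> borel \<rightarrow>\<^sub>M count_space UNIV"
  unfolding cell_def by measurable

lemma X_pt_pos: "lam > 0 \<Longrightarrow> X_pt lam d k > 0"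
  unfolding X_pt_def by (intro add_pos_nonneg) auto

lemma X_pt_last:
  assumes "lam > 0" "d \<ge> 1"
  shows "X_pt lam d d = 1"
  using assms by (simp add: X_pt_def divide_simps)

lemma cell_bounds:
  assumes lam: "lam > 0" and d: "d \<ge> 1" and x: "x \<in> I_set lam"
  shows "X_pt lam d (cell lam d x) \<le> x" "x \<le> Y_pt lam d (cell lam d x)"
proof -
  define h where "h = lam / (real d * (1 + lam))"
  define u where "u = (x - 1 / (1 + lam)) / h"
  have h: "h > 0" using lam d by (simp add: h_def)
  have xu: "x = 1 / (1 + lam) + u * h" using h by (simp add: u_def)
  have u: "u \<ge> 0" using x h by (simp add: u_def I_set_def)
  have cell: "cell lam d x = min (d - 1) (nat \<lfloor>u\<rfloor>)" by (simp add: cell_def u_def h_def)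
  have "real (cell lam d x) \<le> real (nat \<lfloor>u\<rfloor>)" by (simp add: cell)
  also have "\<dots> \<le> u" using u by simp
  finally have "real (cell lam d x) * h \<le> u * h" using h by simp
  then show "X_pt lam d (cell lam d x) \<le> x" by (simp add: X_pt_def xu flip: h_def)
  show "x \<le> Y_pt lam d (cell lam d x)"
  \<comment> \<open>The cases say whether the minimum in \<open>cell\<close> leaves the floor
    unchanged. If it does not, the cell is the last one, whose right end point is 1, and x \<le> 1
    suffices.\<close>
  proof (cases "nat \<lfloor>u\<rfloor> \<le> d - 1")
    case True
    then have "u \<le> real (cell lam d x + 1)" using cell u by linarith
    then have "u * h \<le> real (cell lam d x + 1) * h" using h by simp
    then show ?thesis by (simp add: Y_pt_def X_pt_def xu flip: h_def)
  next
    case False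
    then have "cell lam d x + 1 = d" using d cell by simp
    then show ?thesis using X_pt_last[OF lam d] x by (simp add: Y_pt_def I_set_def)
  qed
qed

text \<open>The product lies in (0, 1], so the denominator is between 1 and 1 + \<open>lam\<close>.
  Thus the parent value also has a cell.\<close>

lemma inverse_prod_mem_I_set:
  fixes \<alpha> :: "nat \<Rightarrow> real"
  assumes lam: "lam > 0" and \<alpha>: "\<forall>j\<in>S. \<alpha> j \<in> I_set lam"
  shows "inverse (1 + lam * (\<Prod>j\<in>S. \<alpha> j)) \<in> I_set lam"
proof -
  have *: "0 < \<alpha> j \<and> \<alpha> j \<le> 1" if "j \<in> S" for j
  proof -
    have "0 < 1 / (1 + lam)" "1 / (1 + lam) \<le> \<alpha> j" "\<alpha> j \<le> 1"
      using lam \<alpha> that by (auto simp: I_set_def)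
    then show ?thesis by linarith
  qed
  have "(\<Prod>j\<in>S. \<alpha> j) > 0" using * by (simp add: prod_pos)
  moreover have "(\<Prod>j\<in>S. \<alpha> j) \<le> 1" using * by (intro prod_le_1) (auto intro: less_imp_le)
  ultimately show ?thesis using lam by (simp add: I_set_def field_simps add_pos_pos)
qed

text \<open>The value \<open>?x\<close> itself witnesses the nonempty intersection. It lies in its
  own cell, and since 1 / (1 + \<open>lam\<close> * p) decreases in p, bounding every factor by the
  end points of its cell puts it into the second interval.\<close>

lemma acceptable_cell:
  fixes M :: "'t::finite branching_matrix" and \<alpha> :: "nat \<Rightarrow> real"
  assumes lam: "lam > 0" and d: "d \<ge> 1"
    and \<alpha>: "\<forall>j\<in>{1..row_size M i}. \<alpha> j \<in> I_set lam"
    and k0: "k 0 = cell lam d (inverse (1 + lam * (\<Prod>j=1..row_size M i. \<alpha> j)))"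
    and k: "\<And>j. j \<in> {1..row_size M i} \<Longrightarrow> k j = cell lam d (\<alpha> j)"
  shows "acceptable M lam d i k"
proof -
  let ?S = "{1..row_size M i}"
  let ?A = "\<Prod>j\<in>?S. \<alpha> j"
  let ?x = "inverse (1 + lam * ?A)"
  note bounds = cell_bounds[OF lam d]
  have "k j < d" if "j \<in> {0..row_size M i}" for j
    using k0 k[of j] that cell_less[OF d] by (cases "j = 0") auto
  moreover have "?x \<in> {X_pt lam d (k 0)..Y_pt lam d (k 0)}"
    using bounds[OF inverse_prod_mem_I_set[OF lam \<alpha>]] by (simp add: k0)
  moreover have "?x \<in> {1 / (1 + lam * (\<Prod>j\<in>?S. Y_pt lam d (k j)))..
      1 / (1 + lam * (\<Prod>j\<in>?S. X_pt lam d (k j)))}"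
  proof -
    have j: "0 < X_pt lam d (k j) \<and> X_pt lam d (k j) \<le> \<alpha> j \<and> \<alpha> j \<le> Y_pt lam d (k j)"
      if "j \<in> ?S" for j
      using bounds[of "\<alpha> j"] \<alpha> k[OF that] that X_pt_pos[OF lam] by simp
    have X: "(\<Prod>j\<in>?S. X_pt lam d (k j)) \<le> ?A"
      using j by (intro prod_mono) (auto intro: less_imp_le)
    have Y: "?A \<le> (\<Prod>j\<in>?S. Y_pt lam d (k j))"
    proof (intro prod_mono conjI)
      show "0 \<le> \<alpha> j" "\<alpha> j \<le> Y_pt lam d (k j)" if "j \<in> ?S" for j using j[OF that] by auto
    qed
    have X0: "0 < (\<Prod>j\<in>?S. X_pt lam d (k j))" using j by (intro prod_pos) auto
    have A0: "0 < ?A" using X X0 by linarith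
    have "1 / (1 + lam * (\<Prod>j\<in>?S. Y_pt lam d (k j))) \<le> 1 / (1 + lam * ?A)"
      using lam A0 Y by (intro divide_left_mono mult_pos_pos add_left_mono mult_left_mono add_pos_pos) auto
    moreover have "1 / (1 + lam * ?A) \<le> 1 / (1 + lam * (\<Prod>j\<in>?S. X_pt lam d (k j)))"
      using lam A0 X0 X by (intro divide_left_mono mult_pos_pos add_left_mono mult_left_mono add_pos_pos) auto
    ultimately show ?thesis by (simp add: inverse_eq_divide)
  qed
  ultimately show ?thesis unfolding acceptable_def by auto
qed

lemma finite_uniform_less_one:
  fixes A :: "real set"
  assumes "finite A" "\<And>r. r \<in> A \<Longrightarrow> r < 1"
  shows "\<exists>\<gamma>>0. \<gamma> < 1 \<and> (\<forall>r\<in>A. r < \<gamma>)"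
proof -
  \<comment> \<open>Inserting 0 covers the empty set and makes the midpoint of \<open>?m\<close> and
    1 positive.\<close>
  let ?m = "Max (insert 0 A)"
  have m: "?m < 1" using assms by simp
  have le: "r \<le> ?m" if "r \<in> insert 0 A" for r using assms(1) that by (rule Max_ge[OF finite.insertI])
  have "\<forall>r\<in>insert 0 A. r < (1 + ?m) / 2" using le m by fastforce
  then show ?thesis using m by (intro exI[of _ "(1 + ?m) / 2"]) simp
qed

theorem theorem4:
  fixes M :: "'t::finite branching_matrix"
    and \<tau> :: "'t \<Rightarrow> nat \<Rightarrow> 't"
    and lam K :: real
    and d :: nat
    and a b :: "'t \<Rightarrow> nat \<Rightarrow> real"
  assumes enum: "enumerates_rows M \<tau>"
    and lam: "lam > 0"
    and d: "d \<ge> 1"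
    and K: "K > 0"
    and cond1: "\<And>i k. acceptable M lam d i k \<Longrightarrow>
      (1 - X_pt lam d (k 0)) *
        (\<Sum>j=1..row_size M i. b (\<tau> i j) (k j) - a (\<tau> i j) (k j) * X_pt lam d (k j))
      < b i (k 0) - a i (k 0) * Y_pt lam d (k 0)"
    and cond2: "\<And>i k. k \<in> {0..<d} \<Longrightarrow>
      b i k - a i k * Y_pt lam d k > 0 \<and> 0 \<le> a i k \<and> a i k \<le> K \<and> 0 \<le> b i k \<and> b i k \<le> K"
  shows "\<exists>(\<gamma>::real) (\<Psi> :: 't \<Rightarrow> real \<Rightarrow> real).
    0 < \<gamma> \<and> \<gamma> < 1 \<and>
    (\<forall>i. (\<forall>x\<in>I_set lam. \<Psi> i x > 0) \<and> set_integrable lborel (I_set lam) (\<Psi> i)) \<and>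
    (\<forall>i (\<alpha> :: nat \<Rightarrow> real). (\<forall>j\<in>{1..row_size M i}. \<alpha> j \<in> I_set lam) \<longrightarrow>
      (let \<alpha>\<^sub>i = inverse (1 + lam * (\<Prod>j=1..row_size M i. \<alpha> j))
       in (1 - \<alpha>\<^sub>i) / \<Psi> i \<alpha>\<^sub>i * (\<Sum>j=1..row_size M i. \<Psi> (\<tau> i j) (\<alpha> j)) < \<gamma>))"
proof -
  let ?X = "X_pt lam d" and ?Y = "Y_pt lam d" and ?c = "cell lam d"
  let ?S = "\<lambda>i. {1..row_size M i}"
  \<comment> \<open>The quotient of the two sides of \<open>cond1\<close>: the worst case of the
    target expression over a tuple of cells.\<close>
  define q where "q i k = (1 - ?X (k 0)) *
      (\<Sum>j\<in>?S i. b (\<tau> i j) (k j) - a (\<tau> i j) (k j) * ?X (k j)) / (b i (k 0) - a i (k 0) * ?Y (k 0))"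
    for i and k :: "nat \<Rightarrow> nat"
  \<comment> \<open>Extensional functions identify tuples that agree on the relevant positions,
    which leaves finitely many.\<close>
  define T where "T i = {k \<in> {0..row_size M i} \<rightarrow>\<^sub>E {0..<d}. acceptable M lam d i k}" for i
  have fin: "finite (\<Union>i. q i ` T i)"
  proof (intro finite_UN_I finite_imageI)
    show "finite (T i)" for i
      by (rule finite_subset[of _ "{0..row_size M i} \<rightarrow>\<^sub>E {0..<d}"]) (auto simp: T_def finite_PiE)
  qed simp
  have less_one: "r < 1" if r: "r \<in> (\<Union>i. q i ` T i)" for r
  proof -
    from r obtain i k where k: "acceptable M lam d i k" and r: "r = q i k" by (auto simp: T_def)
    have "k 0 \<in> {0..<d}" using k by (simp add: acceptable_def)
    \<comment> \<open>The denominator is positive by \<open>cond2\<close>, so dividing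
      \<open>cond1\<close> by it gives \<open>q i k\<close> < 1.\<close>
    then show ?thesis unfolding r q_def using cond1[OF k] cond2[of "k 0" i] by simp
  qed
  obtain \<gamma> where \<gamma>: "0 < \<gamma>" "\<gamma> < 1" and bound: "\<forall>r\<in>(\<Union>i. q i ` T i). r < \<gamma>"
    using finite_uniform_less_one[OF fin less_one] by metis
  have q_less: "q i k < \<gamma>" if "k \<in> T i" for i k
    using that by (intro bound[rule_format]) auto
  define \<Psi> where "\<Psi> i x = b i (?c x) - a i (?c x) * x" for i x
  have c: "?c x \<in> {0..<d}" for x using cell_less[OF d] by simp
  \<comment> \<open>As \<open>a\<close> is nonnegative, \<open>\<Psi> i\<close> is nonincreasing on
    each cell: its values lie between those of the affine piece at the right and the left end
    point.\<close>
  have lower: "0 < b i (?c x) - a i (?c x) * ?Y (?c x)"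
      "b i (?c x) - a i (?c x) * ?Y (?c x) \<le> \<Psi> i x" if "x \<in> I_set lam" for i x
    using cond2[OF c] cell_bounds(2)[OF lam d that] by (auto simp: \<Psi>_def intro: mult_left_mono)
  have upper: "\<Psi> i x \<le> b i (?c x) - a i (?c x) * ?X (?c x)" if "x \<in> I_set lam" for i x
    using cond2[OF c] cell_bounds(1)[OF lam d that] by (auto simp: \<Psi>_def intro: mult_left_mono)
  have pos: "0 < \<Psi> i x" if "x \<in> I_set lam" for i x
    using lower[OF that, of i] by linarith
  have integrable: "set_integrable lborel (I_set lam) (\<Psi> i)" for i
    unfolding set_integrable_def
  proof (rule integrableI_bounded_set_indicator[where B = K])
    show "I_set lam \<in> sets lborel" "emeasure lborel (I_set lam) < \<infinity>"
      by (auto simp: I_set_def emeasure_lborel_Icc_eq)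
    have "(\<lambda>x. b i (?c x)) \<in> borel_measurable borel" "(\<lambda>x. a i (?c x)) \<in> borel_measurable borel"
      by (auto intro: measurable_compose[OF measurable_cell])
    then show "\<Psi> i \<in> borel_measurable lborel" unfolding \<Psi>_def by measurable
    have "norm (\<Psi> i x) \<le> K" if x: "x \<in> I_set lam" for x
    proof -
      \<comment> \<open>Dropping this term from the upper bound leaves \<open>b i (?c x)\<close>,
        which is at most \<open>K\<close>.\<close>
      have "0 \<le> a i (?c x) * ?X (?c x)"
        using cond2[OF c, of i x] X_pt_pos[OF lam, of d "?c x"] by simp
      then show ?thesis using upper[OF x, of i] pos[OF x, of i] cond2[OF c, of i x] by simp
    qed
    then show "AE x in lborel. x \<in> I_set lam \<longrightarrow> norm (\<Psi> i x) \<le> K" by simp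
  qed
  have main: "(1 - x) / \<Psi> i x * (\<Sum>j\<in>?S i. \<Psi> (\<tau> i j) (\<alpha> j)) < \<gamma>"
    if \<alpha>: "\<forall>j\<in>?S i. \<alpha> j \<in> I_set lam" and x: "x = inverse (1 + lam * (\<Prod>j\<in>?S i. \<alpha> j))"
    for i \<alpha> x
  proof -
    \<comment> \<open>Position 0 holds the cell of the parent value; the restriction makes the tuple
      extensional, as membership in \<open>T i\<close> demands.\<close>
    define k where "k = restrict (\<lambda>j. ?c (if j = 0 then x else \<alpha> j)) {0..row_size M i}"
    have k0: "k 0 = ?c x" and k: "\<And>j. j \<in> ?S i \<Longrightarrow> k j = ?c (\<alpha> j)" by (auto simp: k_def)
    have xI: "x \<in> I_set lam" unfolding x by (rule inverse_prod_mem_I_set[OF lam \<alpha>])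
    have "acceptable M lam d i k" using acceptable_cell[OF lam d \<alpha>, of k] k0 k x by blast
    then have "k \<in> T i" using c by (auto simp: T_def k_def)
    then have "q i k < \<gamma>" by (rule q_less)
    moreover have "(1 - x) / \<Psi> i x * (\<Sum>j\<in>?S i. \<Psi> (\<tau> i j) (\<alpha> j)) \<le> q i k"
    proof -
      have "(\<Sum>j\<in>?S i. \<Psi> (\<tau> i j) (\<alpha> j))
          \<le> (\<Sum>j\<in>?S i. b (\<tau> i j) (k j) - a (\<tau> i j) (k j) * ?X (k j))"
        using \<alpha> k upper by (intro sum_mono) simp
      moreover have "0 \<le> (\<Sum>j\<in>?S i. \<Psi> (\<tau> i j) (\<alpha> j))"
        using \<alpha> pos by (intro sum_nonneg) (auto intro: less_imp_le)
      moreover have "0 \<le> 1 - x" "1 - x \<le> 1 - ?X (k 0)"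
        using xI cell_bounds(1)[OF lam d xI] by (auto simp: k0 I_set_def)
      \<comment> \<open>Passing to \<open>q i k\<close> enlarges both nonnegative factors of the
        numerator and shrinks the denominator to a value that is still positive.\<close>
      ultimately have "(1 - x) * (\<Sum>j\<in>?S i. \<Psi> (\<tau> i j) (\<alpha> j)) / \<Psi> i x \<le> q i k"
        unfolding q_def using lower[OF xI, of i] pos[OF xI, of i]
        by (intro frac_le mult_mono mult_nonneg_nonneg) (auto simp: k0)
      then show ?thesis by simp
    qed
    ultimately show ?thesis by linarith
  qed
  show ?thesis
    using \<gamma> pos integrable main by (intro exI[of _ \<gamma>] exI[of _ \<Psi>]) (simp add: Let_def)
qed

end
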